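(* Let $G=\bigoplus_{i=1}^\infty\mathbb{Z}$. Then $\operatorname{rad}(\ell^1(G)'')$ contains nilpotent elements of every index; that is, for every $n\in\mathbb{N}$ there is an element of $\operatorname{rad}(\ell^1(G)'')$ which is nilpotent of index $n$, where $\ell^1(G)''$ carries the first Arens product $\Box$.
   Context: $\mathbb{N}=\{1,2,\ldots\}$. $\bigoplus_{i=1}^\infty\mathbb{Z}=\{(n_i)\in\mathbb{Z}^{\mathbb{N}}: n_i=0\text{ for all but finitely many }i\}$, regarded as a discrete group. For a discrete group $G$, $\ell^1(G)$ is the group algebra of absolutely summable functions $G\to\mathbb{C}$ under convolution. For a Banach algebra $A$ with dual $A'$ and bidual $A''$, the first Arens product $\Box$ on $A''$ is defined by $\langle\Psi\Box\Phi,\lambda\rangle=\langle\Psi,\Phi\cdot\lambda\rangle$, $\langle\Phi\cdot\lambda,a\rangle=\langle\Phi,\lambda\cdot a\rangle$, $\langle\lambda\cdot a,b\rangle=\langle\lambda,ab\rangle$ for $\Phi,\Psi\in A''$, $\lambda\in A'$, $a,b\in A$; it makes $A''$ a Banach algebra extending $A$. For a unital Banach algebra $B$, $\operatorname{rad}(B)$ denotes the Jacobson radical: $\operatorname{rad}(B)=\{a\in B: ba\text{ is quasi-nilpotent for every }b\in B\}$, where $a$ is quasi-nilpotent if $\lim_n\|a^n\|^{1/n}=0$. An element $a$ of an algebra is nilpotent of index $n$ if $a^n=0$ but $a^{n-1}\neq0$ (with $a^0$ the identity). *)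

theory Defs
  imports "HOL-Analysis.Analysis" "HOL-Library.Poly_Mapping"
begin

section \<open>Complex normed spaces and complex Banach algebras\<close>

text \<open>The library only provides real normed spaces and algebras. Completeness and submultiplicativity
  of the norm do not depend on the scalar field; the classes below add a compatible complex scalar
  multiplication.\<close>

class complex_normed_vector = real_normed_vector +
  fixes scaleC :: "complex \<Rightarrow> 'a \<Rightarrow> 'a"  (infixr \<open>*\<^sub>C\<close> 75)
  assumes scaleC_add_right: "c *\<^sub>C (x + y) = c *\<^sub>C x + c *\<^sub>C y"
    and scaleC_add_left: "(c + d) *\<^sub>C x = c *\<^sub>C x + d *\<^sub>C x"
    and scaleC_scaleC: "c *\<^sub>C d *\<^sub>C x = (c * d) *\<^sub>C x"
    and scaleC_of_real: "complex_of_real r *\<^sub>C x = r *\<^sub>R x"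
    and norm_scaleC: "norm (c *\<^sub>C x) = cmod c * norm x"

class complex_normed_algebra = complex_normed_vector + real_normed_algebra +
  assumes mult_scaleC_left: "(c *\<^sub>C x) * y = c *\<^sub>C (x * y)"
    and mult_scaleC_right: "x * (c *\<^sub>C y) = c *\<^sub>C (x * y)"

class complex_banach_algebra = complex_normed_algebra + complete_space

text \<open>A unit is an element \<open>1\<close> with \<open>1 * a = a = a * 1\<close>; no condition on its norm is imposed.\<close>

class complex_banach_algebra_1 = complex_banach_algebra + monoid_mult


section \<open>Nilpotency and the Jacobson radical\<close>

definition quasi_nilpotent :: "'b::complex_banach_algebra_1 \<Rightarrow> bool" where
  "quasi_nilpotent a \<longleftrightarrow> (\<lambda>n. root n (norm (a ^ n))) \<longlonglongrightarrow> 0"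

definition jacobson_radical :: "'b::complex_banach_algebra_1 set" where
  "jacobson_radical = {a. \<forall>b. quasi_nilpotent (b * a)}"

text \<open>Meant for \<open>n \<ge> 1\<close>; for \<open>n = 0\<close> it is unsatisfiable.\<close>

definition nilpotent_of_index :: "'b::{monoid_mult,zero} \<Rightarrow> nat \<Rightarrow> bool" where
  "nilpotent_of_index a n \<longleftrightarrow> a ^ n = 0 \<and> a ^ (n - 1) \<noteq> 0"


section \<open>The dual space\<close>

definition bounded_clinear :: "('a::complex_normed_vector \<Rightarrow> complex) \<Rightarrow> bool" where
  "bounded_clinear f \<longleftrightarrow> bounded_linear f \<and> (\<forall>c x. f (c *\<^sub>C x) = c * f x)"

lemma bounded_clinearI:
  assumes "\<And>x y. f (x + y) = f x + f y" "\<And>c x. f (c *\<^sub>C x) = c * f x"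
    and "\<And>x. norm (f x) \<le> norm x * K"
  shows "bounded_clinear f"
  unfolding bounded_clinear_def
proof (intro conjI allI bounded_linear_intro[of _ K])
  show "f (r *\<^sub>R x) = r *\<^sub>R f x" for r x
    using assms(2)[of "complex_of_real r" x] by (simp add: scaleC_of_real scaleR_conv_of_real)
qed (use assms in auto)

typedef (overloaded) 'a cdual = "{f :: 'a::complex_normed_vector \<Rightarrow> complex. bounded_clinear f}"
  morphisms cdual_apply Cdual
  by (rule exI[of _ "\<lambda>_. 0"]) (auto intro!: bounded_clinearI[of _ 0])

setup_lifting type_definition_cdual

lemma cdual_eqI: "(\<And>x. cdual_apply f x = cdual_apply g x) \<Longrightarrow> f = g"
  by transfer auto

lemma bounded_clinear_cdual_apply: "bounded_clinear (cdual_apply f)"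
  using cdual_apply[of f] by simp

lemma cdual_apply_Cdual: "bounded_clinear f \<Longrightarrow> cdual_apply (Cdual f) = f"
  by (simp add: Cdual_inverse)

lemma bounded_linear_cdual_apply: "bounded_linear (cdual_apply f)"
  using bounded_clinear_cdual_apply[of f] by (simp add: bounded_clinear_def)

lemma cdual_apply_add_right: "cdual_apply f (x + y) = cdual_apply f x + cdual_apply f y"
  using bounded_linear_cdual_apply[of f] by (simp add: linear_simps)

lemma cdual_apply_scaleC_right: "cdual_apply f (c *\<^sub>C x) = c * cdual_apply f x"
  using bounded_clinear_cdual_apply[of f] by (simp add: bounded_clinear_def)

instantiation cdual :: (complex_normed_vector) complex_normed_vector
begin

lift_definition zero_cdual :: "'a cdual" is "\<lambda>_. 0"
  by (auto intro!: bounded_clinearI[of _ 0])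

lift_definition plus_cdual :: "'a cdual \<Rightarrow> 'a cdual \<Rightarrow> 'a cdual" is "\<lambda>f g x. f x + g x"
  by (auto simp: bounded_clinear_def bounded_linear_add algebra_simps)

lift_definition uminus_cdual :: "'a cdual \<Rightarrow> 'a cdual" is "\<lambda>f x. - f x"
  by (auto simp: bounded_clinear_def bounded_linear_minus)

lift_definition minus_cdual :: "'a cdual \<Rightarrow> 'a cdual \<Rightarrow> 'a cdual" is "\<lambda>f g x. f x - g x"
  by (auto simp: bounded_clinear_def bounded_linear_sub algebra_simps)

lift_definition scaleR_cdual :: "real \<Rightarrow> 'a cdual \<Rightarrow> 'a cdual" is "\<lambda>r f x. r *\<^sub>R f x"
  by (auto simp: bounded_clinear_def bounded_linear_const_scaleR)

lift_definition scaleC_cdual :: "complex \<Rightarrow> 'a cdual \<Rightarrow> 'a cdual" is "\<lambda>c f x. c * f x"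
  by (auto simp: bounded_clinear_def bounded_linear_const_mult)

text \<open>\<open>onorm f\<close> is the supremum of \<open>norm (f x) / norm x\<close>.\<close>

lift_definition norm_cdual :: "'a cdual \<Rightarrow> real" is onorm .

definition dist_cdual :: "'a cdual \<Rightarrow> 'a cdual \<Rightarrow> real"
  where "dist_cdual f g = norm (f - g)"

definition sgn_cdual :: "'a cdual \<Rightarrow> 'a cdual"
  where "sgn_cdual f = scaleR (inverse (norm f)) f"

definition uniformity_cdual :: "('a cdual \<times> 'a cdual) filter"
  where "uniformity_cdual = (INF e\<in>{0<..}. principal {(x, y). dist x y < e})"

definition open_cdual :: "'a cdual set \<Rightarrow> bool"
  where "open_cdual S = (\<forall>x\<in>S. \<forall>\<^sub>F (x', y) in uniformity. x' = x \<longrightarrow> y \<in> S)"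

instance
proof
  fix f g h :: "'a cdual" and r s :: real and c d :: complex
  show "f + g + h = f + (g + h)" "f + g = g + f" "0 + f = f" "- f + f = 0" "f - g = f + - g"
    "r *\<^sub>R (f + g) = r *\<^sub>R f + r *\<^sub>R g" "(r + s) *\<^sub>R f = r *\<^sub>R f + s *\<^sub>R f"
    "r *\<^sub>R s *\<^sub>R f = (r * s) *\<^sub>R f" "1 *\<^sub>R f = f"
    "c *\<^sub>C (f + g) = c *\<^sub>C f + c *\<^sub>C g" "(c + d) *\<^sub>C f = c *\<^sub>C f + d *\<^sub>C f"
    "c *\<^sub>C d *\<^sub>C f = (c * d) *\<^sub>C f" "complex_of_real r *\<^sub>C f = r *\<^sub>R f"
    by (transfer; force simp: fun_eq_iff algebra_simps scaleR_conv_of_real)+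
  show "dist f g = norm (f - g)" "sgn f = inverse (norm f) *\<^sub>R f"
    "uniformity = (INF e\<in>{0<..}. principal {(x :: 'a cdual, y). dist x y < e})"
    by (rule dist_cdual_def sgn_cdual_def uniformity_cdual_def)+
  show "open U \<longleftrightarrow> (\<forall>x\<in>U. \<forall>\<^sub>F (x', y) in uniformity. x' = x \<longrightarrow> y \<in> U)" for U :: "'a cdual set"
    by (rule open_cdual_def)
  show norm0: "norm f = 0 \<longleftrightarrow> f = 0" for f :: "'a cdual"
    by transfer (auto simp: bounded_clinear_def onorm_eq_0)
  show "norm (f + g) \<le> norm f + norm g"
    by transfer (auto simp: bounded_clinear_def intro: onorm_triangle)
  show "norm (r *\<^sub>R f) = \<bar>r\<bar> * norm f"
    by transfer (auto simp: bounded_clinear_def intro: onorm_scaleR)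
  have le: "norm (c *\<^sub>C f) \<le> cmod c * norm f" for c and f :: "'a cdual"
  proof transfer
    fix c and f :: "'a \<Rightarrow> complex" assume "bounded_clinear f"
    then have f: "bounded_linear f" by (simp add: bounded_clinear_def)
    show "onorm (\<lambda>x. c * f x) \<le> cmod c * onorm f"
      using mult_left_mono[OF onorm[OF f] norm_ge_zero[of c]] onorm_pos_le[OF f]
      by (intro onorm_bound) (auto simp: norm_mult mult.assoc)
  qed
  show "norm (c *\<^sub>C f) = cmod c * norm f"
  proof (cases "c = 0")
    case True
    then have "c *\<^sub>C f = 0" by transfer auto
    with True norm0 show ?thesis by simp
  next
    case False
    then have "f = inverse c *\<^sub>C c *\<^sub>C f" by transfer auto
    then have "norm f \<le> inverse (cmod c) * norm (c *\<^sub>C f)"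
      using le[of "inverse c" "c *\<^sub>C f"] by (simp add: norm_inverse)
    with False le[of c f] show ?thesis by (simp add: field_simps)
  qed
qed

end

lemma norm_cdual_apply: "norm (cdual_apply f x) \<le> norm f * norm x"
  by transfer (auto simp: bounded_clinear_def intro: onorm)

lemma norm_cdual_bound:
  assumes "0 \<le> b" "\<And>x. norm (cdual_apply f x) \<le> b * norm x"
  shows "norm f \<le> b"
  using assms by transfer (auto intro: onorm_bound)

lemmas cdual_apply_simps [simp] =
  zero_cdual.rep_eq plus_cdual.rep_eq uminus_cdual.rep_eq minus_cdual.rep_eq
  scaleR_cdual.rep_eq scaleC_cdual.rep_eq

instance cdual :: (complex_normed_vector) complete_space
proof
  fix X :: "nat \<Rightarrow> 'a cdual" assume X: "Cauchy X"
  define Y where "Y n = Blinfun (cdual_apply (X n))" for n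
  have Y: "blinfun_apply (Y n) = cdual_apply (X n)" for n
    by (simp add: Y_def bounded_linear_Blinfun_apply bounded_linear_cdual_apply)
  have norm_Y: "norm (Y m - Y n) = norm (X m - X n)" for m n
    unfolding norm_blinfun.rep_eq norm_cdual.rep_eq minus_blinfun.rep_eq minus_cdual.rep_eq Y ..
  have "Cauchy Y" using X by (simp add: Cauchy_def dist_norm norm_Y)
  then obtain L where L: "Y \<longlonglongrightarrow> L" using Cauchy_convergent convergent_def by blast
  have lim: "(\<lambda>n. cdual_apply (X n) x) \<longlonglongrightarrow> blinfun_apply L x" for x
    using blinfun.tendsto[OF L tendsto_const[of x]] by (simp add: Y)
  have "blinfun_apply L (c *\<^sub>C x) = c * blinfun_apply L x" for c x
    using lim[of "c *\<^sub>C x"] tendsto_mult_left[OF lim[of x], of c]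
    by (simp add: cdual_apply_scaleC_right LIMSEQ_unique)
  then have cl: "bounded_clinear (blinfun_apply L)"
    by (simp add: bounded_clinear_def blinfun.bounded_linear_right)
  have "norm (X n - Cdual (blinfun_apply L)) = norm (Y n - L)" for n
    unfolding norm_blinfun.rep_eq norm_cdual.rep_eq minus_blinfun.rep_eq minus_cdual.rep_eq Y
    by (simp add: cdual_apply_Cdual[OF cl])
  then have "X \<longlonglongrightarrow> Cdual (blinfun_apply L)"
    using L by (simp add: LIMSEQ_iff)
  then show "convergent X" by (auto simp: convergent_def)
qed


section \<open>The bidual with the first Arens product\<close>

text \<open>For \<open>\<lambda> \<in> A'\<close>, \<open>a \<in> A\<close>, \<open>\<Phi>, \<Psi> \<in> A''\<close> the three definitions below are
  \<open>\<langle>\<lambda> \<cdot> a, b\<rangle> = \<langle>\<lambda>, ab\<rangle>\<close>, \<open>\<langle>\<Phi> \<cdot> \<lambda>, a\<rangle> = \<langle>\<Phi>, \<lambda> \<cdot> a\<rangle>\<close> and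
  \<open>\<langle>\<Psi> \<box> \<Phi>, \<lambda>\<rangle> = \<langle>\<Psi>, \<Phi> \<cdot> \<lambda>\<rangle>\<close>.\<close>

definition cdual_ract :: "'a::complex_normed_algebra cdual \<Rightarrow> 'a \<Rightarrow> 'a cdual" where
  "cdual_ract l a = Cdual (\<lambda>b. cdual_apply l (a * b))"

definition cdual_lact :: "'a::complex_normed_algebra cdual cdual \<Rightarrow> 'a cdual \<Rightarrow> 'a cdual" where
  "cdual_lact \<Phi> l = Cdual (\<lambda>a. cdual_apply \<Phi> (cdual_ract l a))"

definition arens_product ::
  "'a::complex_normed_algebra cdual cdual \<Rightarrow> 'a cdual cdual \<Rightarrow> 'a cdual cdual"
  (infixl \<open>\<box>\<close> 70) where
  "\<Psi> \<box> \<Phi> = Cdual (\<lambda>l. cdual_apply \<Psi> (cdual_lact \<Phi> l))"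

definition cdual_eval :: "'a::complex_normed_vector \<Rightarrow> 'a cdual cdual" where
  "cdual_eval a = Cdual (\<lambda>l. cdual_apply l a)"

lemma cdual_apply_ract [simp]: "cdual_apply (cdual_ract l a) b = cdual_apply l (a * b)"
proof -
  have "bounded_clinear (\<lambda>b. cdual_apply l (a * b))"
  proof (rule bounded_clinearI)
    show "norm (cdual_apply l (a * x)) \<le> norm x * (norm l * norm a)" for x
      using order_trans[OF norm_cdual_apply mult_left_mono[OF norm_mult_ineq norm_ge_zero]]
      by (simp add: mult_ac)
  qed (simp_all add: distrib_left cdual_apply_add_right mult_scaleC_right cdual_apply_scaleC_right)
  then show ?thesis by (simp add: cdual_ract_def cdual_apply_Cdual)
qed

lemma norm_cdual_ract: "norm (cdual_ract l a) \<le> norm l * norm a"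
proof (rule norm_cdual_bound)
  show "norm (cdual_apply (cdual_ract l a) x) \<le> norm l * norm a * norm x" for x
    using order_trans[OF norm_cdual_apply mult_left_mono[OF norm_mult_ineq norm_ge_zero]]
    by (simp add: mult_ac)
qed simp

lemma cdual_ract_linear:
  "cdual_ract (l + m) a = cdual_ract l a + cdual_ract m a"
  "cdual_ract (c *\<^sub>C l) a = c *\<^sub>C cdual_ract l a"
  "cdual_ract l (a + b) = cdual_ract l a + cdual_ract l b"
  "cdual_ract l (c *\<^sub>C a) = c *\<^sub>C cdual_ract l a"
  by (auto intro!: cdual_eqI simp: distrib_right cdual_apply_add_right mult_scaleC_left
      cdual_apply_scaleC_right)

lemma cdual_apply_lact [simp]: "cdual_apply (cdual_lact \<Phi> l) a = cdual_apply \<Phi> (cdual_ract l a)"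
proof -
  have "bounded_clinear (\<lambda>a. cdual_apply \<Phi> (cdual_ract l a))"
  proof (rule bounded_clinearI)
    show "norm (cdual_apply \<Phi> (cdual_ract l x)) \<le> norm x * (norm \<Phi> * norm l)" for x
      using order_trans[OF norm_cdual_apply mult_left_mono[OF norm_cdual_ract norm_ge_zero]]
      by (simp add: mult_ac)
  qed (simp_all add: cdual_ract_linear cdual_apply_add_right cdual_apply_scaleC_right)
  then show ?thesis by (simp add: cdual_lact_def cdual_apply_Cdual)
qed

lemma norm_cdual_lact: "norm (cdual_lact \<Phi> l) \<le> norm \<Phi> * norm l"
proof (rule norm_cdual_bound)
  show "norm (cdual_apply (cdual_lact \<Phi> l) x) \<le> norm \<Phi> * norm l * norm x" for x
    using order_trans[OF norm_cdual_apply mult_left_mono[OF norm_cdual_ract norm_ge_zero]]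
    by (simp add: mult_ac)
qed simp

lemma cdual_lact_linear:
  "cdual_lact \<Phi> (l + m) = cdual_lact \<Phi> l + cdual_lact \<Phi> m"
  "cdual_lact \<Phi> (c *\<^sub>C l) = c *\<^sub>C cdual_lact \<Phi> l"
  "cdual_lact (\<Phi> + \<Psi>) l = cdual_lact \<Phi> l + cdual_lact \<Psi> l"
  "cdual_lact (c *\<^sub>C \<Phi>) l = c *\<^sub>C cdual_lact \<Phi> l"
  by (auto intro!: cdual_eqI simp: cdual_ract_linear cdual_apply_add_right cdual_apply_scaleC_right)

lemma cdual_apply_arens [simp]: "cdual_apply (\<Psi> \<box> \<Phi>) l = cdual_apply \<Psi> (cdual_lact \<Phi> l)"
proof -
  have "bounded_clinear (\<lambda>l. cdual_apply \<Psi> (cdual_lact \<Phi> l))"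
  proof (rule bounded_clinearI)
    show "norm (cdual_apply \<Psi> (cdual_lact \<Phi> l)) \<le> norm l * (norm \<Psi> * norm \<Phi>)" for l
      using order_trans[OF norm_cdual_apply[of \<Psi>] mult_left_mono[OF norm_cdual_lact norm_ge_zero]]
      by (simp add: mult_ac)
  qed (simp_all add: cdual_lact_linear cdual_apply_add_right cdual_apply_scaleC_right)
  then show ?thesis by (simp add: arens_product_def cdual_apply_Cdual)
qed

lemma norm_arens: "norm (\<Psi> \<box> \<Phi>) \<le> norm \<Psi> * norm \<Phi>"
proof (rule norm_cdual_bound)
  show "norm (cdual_apply (\<Psi> \<box> \<Phi>) x) \<le> norm \<Psi> * norm \<Phi> * norm x" for x
    using order_trans[OF norm_cdual_apply[of \<Psi>] mult_left_mono[OF norm_cdual_lact norm_ge_zero]]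
    by (simp add: mult_ac)
qed simp

lemma arens_linear:
  "(\<Psi> + \<Psi>') \<box> \<Phi> = \<Psi> \<box> \<Phi> + \<Psi>' \<box> \<Phi>" "\<Psi> \<box> (\<Phi> + \<Phi>') = \<Psi> \<box> \<Phi> + \<Psi> \<box> \<Phi>'"
  "(c *\<^sub>C \<Psi>) \<box> \<Phi> = c *\<^sub>C (\<Psi> \<box> \<Phi>)" "\<Psi> \<box> (c *\<^sub>C \<Phi>) = c *\<^sub>C (\<Psi> \<box> \<Phi>)"
  by (auto intro!: cdual_eqI simp: cdual_lact_linear cdual_apply_add_right cdual_apply_scaleC_right)

lemma arens_assoc: "(\<Theta> \<box> \<Psi>) \<box> \<Phi> = \<Theta> \<box> (\<Psi> \<box> \<Phi>)"
proof -
  have "cdual_ract (cdual_ract l a) b = cdual_ract l (a * b)" for l :: "'a cdual" and a b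
    by (intro cdual_eqI) (simp add: mult.assoc)
  then have "cdual_lact \<Phi> (cdual_ract l a) = cdual_ract (cdual_lact \<Phi> l) a" for l a
    by (intro cdual_eqI) simp
  then have "cdual_lact (\<Psi> \<box> \<Phi>) l = cdual_lact \<Psi> (cdual_lact \<Phi> l)" for l
    by (intro cdual_eqI) simp
  then show ?thesis
    by (intro cdual_eqI) simp
qed

lemma cdual_apply_eval [simp]: "cdual_apply (cdual_eval a) l = cdual_apply l a"
proof -
  have "bounded_clinear (\<lambda>l. cdual_apply l a)"
    by (rule bounded_clinearI[of _ "norm a"]) (auto simp: norm_cdual_apply)
  then show ?thesis by (simp add: cdual_eval_def cdual_apply_Cdual)
qed

text \<open>The Arens product extends the product of the algebra.\<close>

lemma arens_eval: "cdual_eval a \<box> cdual_eval b = cdual_eval (a * b)"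
  by (intro cdual_eqI) simp

text \<open>\<open>'a bidual\<close> is a copy of \<open>'a cdual cdual\<close>, with the same linear and norm structure, on
  which the first Arens product can be registered as the multiplication.\<close>

typedef (overloaded) 'a bidual = "UNIV :: 'a::complex_normed_vector cdual cdual set"
  morphisms of_bidual to_bidual ..

setup_lifting type_definition_bidual

instantiation bidual :: (complex_normed_vector) complex_normed_vector
begin

lift_definition zero_bidual :: "'a bidual" is 0 .
lift_definition plus_bidual :: "'a bidual \<Rightarrow> 'a bidual \<Rightarrow> 'a bidual" is "(+)" .
lift_definition uminus_bidual :: "'a bidual \<Rightarrow> 'a bidual" is uminus .
lift_definition minus_bidual :: "'a bidual \<Rightarrow> 'a bidual \<Rightarrow> 'a bidual" is "(-)" .
lift_definition scaleR_bidual :: "real \<Rightarrow> 'a bidual \<Rightarrow> 'a bidual" is scaleR .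
lift_definition scaleC_bidual :: "complex \<Rightarrow> 'a bidual \<Rightarrow> 'a bidual" is scaleC .
lift_definition norm_bidual :: "'a bidual \<Rightarrow> real" is norm .

definition dist_bidual :: "'a bidual \<Rightarrow> 'a bidual \<Rightarrow> real"
  where "dist_bidual f g = norm (f - g)"

definition sgn_bidual :: "'a bidual \<Rightarrow> 'a bidual"
  where "sgn_bidual f = scaleR (inverse (norm f)) f"

definition uniformity_bidual :: "('a bidual \<times> 'a bidual) filter"
  where "uniformity_bidual = (INF e\<in>{0<..}. principal {(x, y). dist x y < e})"

definition open_bidual :: "'a bidual set \<Rightarrow> bool"
  where "open_bidual S = (\<forall>x\<in>S. \<forall>\<^sub>F (x', y) in uniformity. x' = x \<longrightarrow> y \<in> S)"

instance
proof
  fix f g h :: "'a bidual" and r s :: real and c d :: complex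
  show "f + g + h = f + (g + h)" "f + g = g + f" "0 + f = f" "- f + f = 0" "f - g = f + - g"
    "r *\<^sub>R (f + g) = r *\<^sub>R f + r *\<^sub>R g" "(r + s) *\<^sub>R f = r *\<^sub>R f + s *\<^sub>R f"
    "r *\<^sub>R s *\<^sub>R f = (r * s) *\<^sub>R f" "1 *\<^sub>R f = f"
    by (transfer; simp add: algebra_simps)+
  show "c *\<^sub>C (f + g) = c *\<^sub>C f + c *\<^sub>C g" "(c + d) *\<^sub>C f = c *\<^sub>C f + d *\<^sub>C f"
    "c *\<^sub>C d *\<^sub>C f = (c * d) *\<^sub>C f" "complex_of_real r *\<^sub>C f = r *\<^sub>R f"
    "norm (c *\<^sub>C f) = cmod c * norm f"
    by (transfer; rule scaleC_add_right scaleC_add_left scaleC_scaleC scaleC_of_real norm_scaleC)+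
  show "dist f g = norm (f - g)" "sgn f = inverse (norm f) *\<^sub>R f"
    "uniformity = (INF e\<in>{0<..}. principal {(x :: 'a bidual, y). dist x y < e})"
    by (rule dist_bidual_def sgn_bidual_def uniformity_bidual_def)+
  show "open U \<longleftrightarrow> (\<forall>x\<in>U. \<forall>\<^sub>F (x', y) in uniformity. x' = x \<longrightarrow> y \<in> U)" for U :: "'a bidual set"
    by (rule open_bidual_def)
  show "norm f = 0 \<longleftrightarrow> f = 0" "norm (f + g) \<le> norm f + norm g" "norm (r *\<^sub>R f) = \<bar>r\<bar> * norm f"
    by (transfer; simp add: norm_triangle_ineq)+
qed

end

instance bidual :: (complex_normed_vector) complete_space
proof
  fix X :: "nat \<Rightarrow> 'a bidual" assume X: "Cauchy X"
  have *: "norm (of_bidual x - of_bidual y) = norm (x - y)" for x y :: "'a bidual"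
    by transfer simp
  have "Cauchy (\<lambda>n. of_bidual (X n))" using X by (simp add: Cauchy_def dist_norm *)
  then obtain L where "(\<lambda>n. of_bidual (X n)) \<longlonglongrightarrow> L"
    using Cauchy_convergent convergent_def by blast
  then have "X \<longlonglongrightarrow> to_bidual L"
    using *[of _ "to_bidual L"] by (simp add: LIMSEQ_iff to_bidual_inverse)
  then show "convergent X" by (auto simp: convergent_def)
qed

instantiation bidual :: (complex_normed_algebra) complex_normed_algebra
begin

lift_definition times_bidual :: "'a bidual \<Rightarrow> 'a bidual \<Rightarrow> 'a bidual" is arens_product .

instance
proof
  fix x y z :: "'a bidual" and r :: real and c :: complex
  show "x * y * z = x * (y * z)" "(x + y) * z = x * z + y * z" "x * (y + z) = x * y + x * z"
    "norm (x * y) \<le> norm x * norm y"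
    by (transfer; rule arens_assoc arens_linear norm_arens)+
  show C: "c *\<^sub>C x * y = c *\<^sub>C (x * y)" "x * c *\<^sub>C y = c *\<^sub>C (x * y)" for c
    by (transfer; rule arens_linear)+
  show "r *\<^sub>R x * y = r *\<^sub>R (x * y)" "x * r *\<^sub>R y = r *\<^sub>R (x * y)"
    using C[of "complex_of_real r"] by (simp_all add: scaleC_of_real)
qed

end

instance bidual :: (complex_banach_algebra) complex_banach_algebra ..

instantiation bidual :: (complex_banach_algebra_1) complex_banach_algebra_1
begin

lift_definition one_bidual :: "'a bidual" is "cdual_eval 1" .

instance
proof
  fix a :: "'a bidual"
  have ract_1: "cdual_ract l 1 = l" for l :: "'a cdual"
    by (rule cdual_eqI) simp
  have lact_1: "cdual_lact (cdual_eval 1) l = l" for l :: "'a cdual"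
    by (rule cdual_eqI) simp
  show "1 * a = a"
    by transfer (auto intro!: cdual_eqI simp: ract_1)
  show "a * 1 = a"
    by transfer (auto intro!: cdual_eqI simp: lact_1)
qed

end


section \<open>The group algebra\<close>

typedef 'g ell1 = "{f :: 'g \<Rightarrow> complex. (\<lambda>x. norm (f x)) summable_on UNIV}"
  morphisms ell1_apply Ell1
  by (rule exI[of _ "\<lambda>_. 0"]) simp

setup_lifting type_definition_ell1

lemma ell1_eqI: "(\<And>x. ell1_apply f x = ell1_apply g x) \<Longrightarrow> f = g"
  by transfer auto

lemma ell1_summable: "(\<lambda>x. norm (ell1_apply f x)) summable_on UNIV"
  using ell1_apply[of f] by simp

instantiation ell1 :: (type) complex_normed_vector
begin

lift_definition zero_ell1 :: "'a ell1" is "\<lambda>_. 0" by simp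

lift_definition plus_ell1 :: "'a ell1 \<Rightarrow> 'a ell1 \<Rightarrow> 'a ell1" is "\<lambda>f g x. f x + g x"
proof -
  fix f g :: "'a \<Rightarrow> complex"
  assume "(\<lambda>x. norm (f x)) summable_on UNIV" "(\<lambda>x. norm (g x)) summable_on UNIV"
  from summable_on_add[OF this] show "(\<lambda>x. norm (f x + g x)) summable_on UNIV"
    by (rule Infinite_Sum.abs_summable_on_comparison_test') (rule norm_triangle_ineq)
qed

lift_definition uminus_ell1 :: "'a ell1 \<Rightarrow> 'a ell1" is "\<lambda>f x. - f x" by simp

lift_definition minus_ell1 :: "'a ell1 \<Rightarrow> 'a ell1 \<Rightarrow> 'a ell1" is "\<lambda>f g x. f x - g x"
proof -
  fix f g :: "'a \<Rightarrow> complex"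
  assume "(\<lambda>x. norm (f x)) summable_on UNIV" "(\<lambda>x. norm (g x)) summable_on UNIV"
  from summable_on_add[OF this] show "(\<lambda>x. norm (f x - g x)) summable_on UNIV"
    by (rule Infinite_Sum.abs_summable_on_comparison_test') (rule norm_triangle_ineq4)
qed

lift_definition scaleR_ell1 :: "real \<Rightarrow> 'a ell1 \<Rightarrow> 'a ell1" is "\<lambda>r f x. r *\<^sub>R f x"
  by (auto intro: summable_on_cmult_right)

lift_definition scaleC_ell1 :: "complex \<Rightarrow> 'a ell1 \<Rightarrow> 'a ell1" is "\<lambda>c f x. c * f x"
  by (auto simp: norm_mult intro: summable_on_cmult_right)

lift_definition norm_ell1 :: "'a ell1 \<Rightarrow> real" is "\<lambda>f. \<Sum>\<^sub>\<infinity>x. norm (f x)" .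

definition dist_ell1 :: "'a ell1 \<Rightarrow> 'a ell1 \<Rightarrow> real"
  where "dist_ell1 f g = norm (f - g)"

definition sgn_ell1 :: "'a ell1 \<Rightarrow> 'a ell1"
  where "sgn_ell1 f = scaleR (inverse (norm f)) f"

definition uniformity_ell1 :: "('a ell1 \<times> 'a ell1) filter"
  where "uniformity_ell1 = (INF e\<in>{0<..}. principal {(x, y). dist x y < e})"

definition open_ell1 :: "'a ell1 set \<Rightarrow> bool"
  where "open_ell1 S = (\<forall>x\<in>S. \<forall>\<^sub>F (x', y) in uniformity. x' = x \<longrightarrow> y \<in> S)"

instance
proof
  fix f g h :: "'a ell1" and r s :: real and c d :: complex
  show "f + g + h = f + (g + h)" "f + g = g + f" "0 + f = f" "- f + f = 0" "f - g = f + - g"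
    "r *\<^sub>R (f + g) = r *\<^sub>R f + r *\<^sub>R g" "(r + s) *\<^sub>R f = r *\<^sub>R f + s *\<^sub>R f"
    "r *\<^sub>R s *\<^sub>R f = (r * s) *\<^sub>R f" "1 *\<^sub>R f = f"
    "c *\<^sub>C (f + g) = c *\<^sub>C f + c *\<^sub>C g" "(c + d) *\<^sub>C f = c *\<^sub>C f + d *\<^sub>C f"
    "c *\<^sub>C d *\<^sub>C f = (c * d) *\<^sub>C f" "complex_of_real r *\<^sub>C f = r *\<^sub>R f"
    by (transfer; force simp: fun_eq_iff algebra_simps scaleR_conv_of_real)+
  show "dist f g = norm (f - g)" "sgn f = inverse (norm f) *\<^sub>R f"
    "uniformity = (INF e\<in>{0<..}. principal {(x :: 'a ell1, y). dist x y < e})"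
    by (rule dist_ell1_def sgn_ell1_def uniformity_ell1_def)+
  show "open U \<longleftrightarrow> (\<forall>x\<in>U. \<forall>\<^sub>F (x', y) in uniformity. x' = x \<longrightarrow> y \<in> U)" for U :: "'a ell1 set"
    by (rule open_ell1_def)
  show "norm f = 0 \<longleftrightarrow> f = 0"
  proof transfer
    fix f :: "'a \<Rightarrow> complex" assume f: "(\<lambda>x. norm (f x)) summable_on UNIV"
    have "norm (f x) \<le> (\<Sum>\<^sub>\<infinity>x. norm (f x))" for x
      using finite_sum_le_infsum[of "\<lambda>x. norm (f x)" UNIV "{x}"] f by simp
    then show "(\<Sum>\<^sub>\<infinity>x. norm (f x)) = 0 \<longleftrightarrow> f = (\<lambda>_. 0)"
      by (auto simp: fun_eq_iff)
  qed
  show "norm (f + g) \<le> norm f + norm g"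
  proof transfer
    fix f g :: "'a \<Rightarrow> complex"
    assume fg: "(\<lambda>x. norm (f x)) summable_on UNIV" "(\<lambda>x. norm (g x)) summable_on UNIV"
    have "(\<lambda>x. norm (f x + g x)) summable_on UNIV"
      by (rule Infinite_Sum.abs_summable_on_comparison_test'[OF summable_on_add[OF fg]]) (rule norm_triangle_ineq)
    then have "(\<Sum>\<^sub>\<infinity>x. norm (f x + g x)) \<le> (\<Sum>\<^sub>\<infinity>x. norm (f x) + norm (g x))"
      by (rule infsum_mono[OF _ summable_on_add[OF fg]]) (rule norm_triangle_ineq)
    then show "(\<Sum>\<^sub>\<infinity>x. norm (f x + g x)) \<le> (\<Sum>\<^sub>\<infinity>x. norm (f x)) + (\<Sum>\<^sub>\<infinity>x. norm (g x))"
      by (simp add: infsum_add[OF fg])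
  qed
  show "norm (r *\<^sub>R f) = \<bar>r\<bar> * norm f"
    by transfer (simp add: infsum_cmult_right')
  show "norm (c *\<^sub>C f) = cmod c * norm f"
    by transfer (simp add: norm_mult infsum_cmult_right')
qed

end

lemma norm_ell1_apply: "norm (ell1_apply f x) \<le> norm f"
  using finite_sum_le_infsum[OF ell1_summable[of f], of "{x}"] by (simp add: norm_ell1.rep_eq)

instance ell1 :: (type) complete_space
proof
  fix X :: "nat \<Rightarrow> 'a ell1" assume X: "Cauchy X"
  have "Cauchy (\<lambda>n. ell1_apply (X n) x)" for x
  proof (rule CauchyI)
    fix e :: real assume "e > 0"
    then obtain N where "\<forall>m\<ge>N. \<forall>n\<ge>N. norm (X m - X n) < e" using X by (auto simp: Cauchy_iff)
    moreover have "norm (ell1_apply (X m) x - ell1_apply (X n) x) \<le> norm (X m - X n)" for m n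
      using norm_ell1_apply[of "X m - X n" x] by (simp add: minus_ell1.rep_eq)
    ultimately show "\<exists>N. \<forall>m\<ge>N. \<forall>n\<ge>N. norm (ell1_apply (X m) x - ell1_apply (X n) x) < e"
      by (meson le_less_trans)
  qed
  then have "\<exists>l. (\<lambda>n. ell1_apply (X n) x) \<longlonglongrightarrow> l" for x
    using Cauchy_convergent convergent_def by blast
  then obtain L where L: "\<And>x. (\<lambda>n. ell1_apply (X n) x) \<longlonglongrightarrow> L x" by metis
  have bound: "(\<Sum>x\<in>F. norm (ell1_apply (X n) x - L x)) \<le> e"
    if N: "\<forall>m\<ge>N. \<forall>n\<ge>N. norm (X m - X n) < e" and "n \<ge> N" "finite F" for e N n F
  proof (rule LIMSEQ_le_const2)
    show "(\<lambda>m. \<Sum>x\<in>F. norm (ell1_apply (X n) x - ell1_apply (X m) x))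
      \<longlonglongrightarrow> (\<Sum>x\<in>F. norm (ell1_apply (X n) x - L x))"
      by (intro tendsto_sum tendsto_norm tendsto_diff tendsto_const L)
    have "(\<Sum>x\<in>F. norm (ell1_apply (X n) x - ell1_apply (X m) x)) \<le> norm (X n - X m)" for m
      using finite_sum_le_infsum[OF ell1_summable[of "X n - X m"] \<open>finite F\<close>]
      by (simp add: norm_ell1.rep_eq minus_ell1.rep_eq)
    then show "\<exists>M. \<forall>m\<ge>M. (\<Sum>x\<in>F. norm (ell1_apply (X n) x - ell1_apply (X m) x)) \<le> e"
      using N \<open>n \<ge> N\<close> by (meson less_imp_le order_trans)
  qed
  have summ: "(\<lambda>x. norm (ell1_apply (X n) x - L x)) summable_on UNIV"
    if N: "\<forall>m\<ge>N. \<forall>n\<ge>N. norm (X m - X n) < e" and "n \<ge> N" for e N n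
    by (rule nonneg_bdd_above_summable_on) (auto intro!: bdd_aboveI[of _ e] bound[OF N \<open>n \<ge> N\<close>])
  obtain N where N: "\<forall>m\<ge>N. \<forall>n\<ge>N. norm (X m - X n) < 1" using X by (force simp: Cauchy_iff)
  have "(\<lambda>x. norm (ell1_apply (X N) x - (ell1_apply (X N) x - L x))) summable_on UNIV"
    by (rule Infinite_Sum.abs_summable_on_comparison_test'
        [OF summable_on_add[OF ell1_summable[of "X N"] summ[OF N order_refl]]])
      (rule norm_triangle_ineq4)
  then have "ell1_apply (Ell1 L) = L" by (simp add: Ell1_inverse)
  have "X \<longlonglongrightarrow> Ell1 L"
  proof (rule LIMSEQ_I)
    fix e :: real assume "e > 0"
    then obtain N where N: "\<forall>m\<ge>N. \<forall>n\<ge>N. norm (X m - X n) < e / 2"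
      using X by (meson Cauchy_iff half_gt_zero)
    have "norm (X n - Ell1 L) \<le> e / 2" if "n \<ge> N" for n
      unfolding norm_ell1.rep_eq minus_ell1.rep_eq \<open>ell1_apply (Ell1 L) = L\<close>
      using summ[OF N that] by (rule infsum_le_finite_sums) (rule bound[OF N that])
    with \<open>e > 0\<close> show "\<exists>N. \<forall>n\<ge>N. norm (X n - Ell1 L) < e" by (intro exI[of _ N]) force
  qed
  then show "convergent X" by (auto simp: convergent_def)
qed

text \<open>Multiplication is convolution, \<open>(f * g)(x) = (\<Sum>y. f(y) g(y\<^sup>-\<^sup>1 x))\<close> with the group
  written additively. The order of \<open>- y + x\<close> matters only for non-abelian groups.\<close>

definition convolve :: "('g::group_add \<Rightarrow> complex) \<Rightarrow> ('g \<Rightarrow> complex) \<Rightarrow> 'g \<Rightarrow> complex" where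
  "convolve f g x = (\<Sum>\<^sub>\<infinity>y. f y * g (- y + x))"

lemma bij_add_left: "bij ((+) (a :: 'g::group_add))"
  by (rule bij_betw_byWitness[of _ "\<lambda>x. - a + x"]) (auto simp: add.assoc[symmetric])

lemma infsum_shift: "(\<Sum>\<^sub>\<infinity>x. h (- y + x :: 'g::group_add)) = infsum h UNIV"
  using infsum_reindex_bij_betw[OF bij_add_left[of "- y"], of h] by simp

lemma summable_shift: "(\<lambda>x. h (- y + x :: 'g::group_add)) summable_on UNIV \<longleftrightarrow> h summable_on UNIV"
  using summable_on_reindex_bij_betw[OF bij_add_left[of "- y"], of h] by simp

lemma convolve_summable_Sigma:
  fixes f g :: "'g::group_add \<Rightarrow> complex"
  assumes f: "(\<lambda>x. norm (f x)) summable_on UNIV" and g: "(\<lambda>x. norm (g x)) summable_on UNIV"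
  shows "(\<lambda>(y, x). norm (f y * g (- y + x))) summable_on UNIV \<times> UNIV"
proof -
  have "(\<lambda>p. norm (case p of (y, x) \<Rightarrow> f y * g (- y + x))) summable_on UNIV \<times> UNIV"
    using f g
    by (subst Infinite_Sum.abs_summable_on_Sigma_iff)
      (auto simp: norm_mult abs_mult infsum_nonneg infsum_cmult_right' infsum_shift[of "\<lambda>x. norm (g x)"]
        summable_shift[of "\<lambda>x. norm (g x)"] intro!: summable_on_cmult_right summable_on_cmult_left)
  then show ?thesis by (simp add: case_prod_unfold)
qed

lemma
  fixes f g :: "'g::group_add \<Rightarrow> complex"
  assumes f: "(\<lambda>x. norm (f x)) summable_on UNIV" and g: "(\<lambda>x. norm (g x)) summable_on UNIV"
  shows convolve_summable: "(\<lambda>y. norm (f y * g (- y + x))) summable_on UNIV"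
    and convolve_abs_summable: "(\<lambda>x. norm (convolve f g x)) summable_on UNIV"
    and norm_convolve: "(\<Sum>\<^sub>\<infinity>x. norm (convolve f g x)) \<le> (\<Sum>\<^sub>\<infinity>x. norm (f x)) * (\<Sum>\<^sub>\<infinity>x. norm (g x))"
proof -
  note S = convolve_summable_Sigma[OF f g]
  have S': "(\<lambda>(x, y). norm (f y * g (- y + x))) summable_on UNIV \<times> UNIV"
    using S by (subst (asm) summable_on_swap) (simp add: case_prod_unfold)
  have "(\<lambda>p. norm (case p of (x, y) \<Rightarrow> f y * g (- y + x))) summable_on UNIV \<times> UNIV"
    using S' by (simp add: case_prod_unfold)
  then have 1: "(\<lambda>y. norm (f y * g (- y + x))) summable_on UNIV" for x
    by (subst (asm) Infinite_Sum.abs_summable_on_Sigma_iff) auto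
  have 2: "(\<lambda>x. \<Sum>\<^sub>\<infinity>y. norm (f y * g (- y + x))) summable_on UNIV"
    using summable_on_Sigma_banach[OF S'] by simp
  show "(\<lambda>y. norm (f y * g (- y + x))) summable_on UNIV" by (rule 1)
  have le: "norm (convolve f g x) \<le> (\<Sum>\<^sub>\<infinity>y. norm (f y * g (- y + x)))" for x
    unfolding convolve_def by (rule norm_infsum_bound) (rule 1)
  show 3: "(\<lambda>x. norm (convolve f g x)) summable_on UNIV"
    by (rule Infinite_Sum.abs_summable_on_comparison_test'[OF 2 le])
  have "(\<Sum>\<^sub>\<infinity>x. norm (convolve f g x)) \<le> (\<Sum>\<^sub>\<infinity>x. \<Sum>\<^sub>\<infinity>y. norm (f y * g (- y + x)))"
    by (rule infsum_mono[OF 3 2 le])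
  also have "\<dots> = (\<Sum>\<^sub>\<infinity>y. \<Sum>\<^sub>\<infinity>x. norm (f y * g (- y + x)))"
    by (rule infsum_swap_banach[OF S'])
  also have "\<dots> = (\<Sum>\<^sub>\<infinity>x. norm (f x)) * (\<Sum>\<^sub>\<infinity>x. norm (g x))"
    by (simp add: norm_mult infsum_cmult_right' infsum_cmult_left' infsum_shift[of "\<lambda>x. norm (g x)"])
  finally show "(\<Sum>\<^sub>\<infinity>x. norm (convolve f g x)) \<le> (\<Sum>\<^sub>\<infinity>x. norm (f x)) * (\<Sum>\<^sub>\<infinity>x. norm (g x))" .
qed

lemma convolve_assoc:
  fixes f g h :: "'g::group_add \<Rightarrow> complex"
  assumes f: "(\<lambda>x. norm (f x)) summable_on UNIV" and g: "(\<lambda>x. norm (g x)) summable_on UNIV"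
    and h: "(\<lambda>x. norm (h x)) summable_on UNIV"
  shows "convolve (convolve f g) h = convolve f (convolve g h)"
proof
  fix x
  define K where "K = (\<Sum>\<^sub>\<infinity>x. norm (h x))"
  have K: "norm (h x) \<le> K" for x
    using finite_sum_le_infsum[OF h, of "{x}"] by (simp add: K_def)
  have "(\<lambda>p. norm ((\<lambda>(y, z). f y * g (- y + z) * h (- z + x)) p)) summable_on UNIV \<times> UNIV"
    by (rule Infinite_Sum.abs_summable_on_comparison_test'
        [OF summable_on_cmult_left[OF convolve_summable_Sigma[OF f g], of K]])
      (auto simp: norm_mult intro!: mult_left_mono K)
  then have S: "(\<lambda>(y, z). f y * g (- y + z) * h (- z + x)) summable_on UNIV \<times> UNIV"
    by (rule abs_summable_summable)
  have "convolve (convolve f g) h x = (\<Sum>\<^sub>\<infinity>z. \<Sum>\<^sub>\<infinity>y. f y * g (- y + z) * h (- z + x))"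
    by (simp add: convolve_def infsum_cmult_left')
  also have "\<dots> = (\<Sum>\<^sub>\<infinity>y. \<Sum>\<^sub>\<infinity>z. f y * g (- y + z) * h (- z + x))"
    by (rule infsum_swap_banach[OF S, symmetric])
  also have "(\<Sum>\<^sub>\<infinity>z. f y * g (- y + z) * h (- z + x)) = f y * convolve g h (- y + x)" for y
    using infsum_shift[of "\<lambda>w. g w * h (- w + (- y + x))" y]
    by (simp add: convolve_def mult.assoc infsum_cmult_right' minus_add add.assoc[symmetric])
  then have "(\<Sum>\<^sub>\<infinity>y. \<Sum>\<^sub>\<infinity>z. f y * g (- y + z) * h (- z + x)) = convolve f (convolve g h) x"
    by (simp add: convolve_def)
  finally show "convolve (convolve f g) h x = convolve f (convolve g h) x" .
qed

instantiation ell1 :: (group_add) complex_normed_algebra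
begin

lift_definition times_ell1 :: "'a ell1 \<Rightarrow> 'a ell1 \<Rightarrow> 'a ell1" is convolve
  by (simp add: convolve_abs_summable)

instance
proof
  fix f g h :: "'a ell1" and r :: real and c :: complex
  have *: "(\<lambda>y. ell1_apply f y * ell1_apply g (- y + x)) summable_on UNIV" for f g :: "'a ell1" and x
    by (rule abs_summable_summable[OF convolve_summable[OF ell1_summable ell1_summable]])
  show "f * g * h = f * (g * h)"
    by transfer (simp add: convolve_assoc)
  show "(f + g) * h = f * h + g * h"
    by (rule ell1_eqI)
      (simp add: times_ell1.rep_eq plus_ell1.rep_eq convolve_def distrib_right infsum_add[OF * *])
  show "f * (g + h) = f * g + f * h"
    by (rule ell1_eqI)
      (simp add: times_ell1.rep_eq plus_ell1.rep_eq convolve_def distrib_left infsum_add[OF * *])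
  show "norm (f * g) \<le> norm f * norm g"
    by transfer (simp add: norm_convolve)
  show C: "(c *\<^sub>C f) * g = c *\<^sub>C (f * g)" "f * (c *\<^sub>C g) = c *\<^sub>C (f * g)" for c
    by (rule ell1_eqI; simp add: times_ell1.rep_eq scaleC_ell1.rep_eq convolve_def mult.assoc
        mult.left_commute[of "ell1_apply f _" c] infsum_cmult_right')+
  show "r *\<^sub>R f * g = r *\<^sub>R (f * g)" "f * r *\<^sub>R g = r *\<^sub>R (f * g)"
    using C[of "complex_of_real r"] by (simp_all add: scaleC_of_real)
qed

end

instance ell1 :: (group_add) complex_banach_algebra ..

instantiation ell1 :: (group_add) complex_banach_algebra_1
begin

lift_definition one_ell1 :: "'a ell1" is "\<lambda>x. if x = 0 then 1 else 0"
proof -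
  have "(\<lambda>x::'a. norm (if x = 0 then 1 else 0 :: complex)) summable_on {0}" by simp
  then show "(\<lambda>x::'a. norm (if x = 0 then 1 else 0 :: complex)) summable_on UNIV"
    by (rule summable_on_cong_neutral[THEN iffD1, rotated 3]) auto
qed

instance
proof
  fix f :: "'a ell1"
  have "(\<Sum>\<^sub>\<infinity>y. (if y = 0 then 1 else 0) * ell1_apply f (- y + x)) = ell1_apply f x" for x
  proof -
    have "(\<Sum>\<^sub>\<infinity>y. (if y = 0 then 1 else 0) * ell1_apply f (- y + x))
      = (\<Sum>\<^sub>\<infinity>y\<in>{0::'a}. ell1_apply f x)"
      by (rule infsum_cong_neutral) auto
    then show ?thesis by simp
  qed
  then show "1 * f = f"
    by (intro ell1_eqI) (simp add: times_ell1.rep_eq one_ell1.rep_eq convolve_def)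
  have "(\<Sum>\<^sub>\<infinity>y. ell1_apply f y * (if - y + x = 0 then 1 else 0)) = ell1_apply f x" for x
  proof -
    have "- y + x = 0 \<longleftrightarrow> y = x" for y
      using neg_eq_iff_add_eq_0[of "- y" x] by simp
    then have "(\<Sum>\<^sub>\<infinity>y. ell1_apply f y * (if - y + x = 0 then 1 else 0))
      = (\<Sum>\<^sub>\<infinity>y\<in>{x}. ell1_apply f x)"
      by (intro infsum_cong_neutral) auto
    then show ?thesis by simp
  qed
  then show "f * 1 = f"
    by (intro ell1_eqI) (simp add: times_ell1.rep_eq one_ell1.rep_eq convolve_def)
qed

end

end

theory Submission
  imports Defs
begin

text \<open>Write \<open>e\<^sub>i\<close> for the \<open>i\<close>-th unit vector of the group. Averaging a bounded function along
  \<open>0, e\<^sub>i, 2 e\<^sub>i, \<dots>\<close> and along \<open>0, - e\<^sub>i, - 2 e\<^sub>i, \<dots>\<close> by a Banach limit gives two means that are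
  invariant under translation by \<open>e\<^sub>i\<close>; let \<open>D\<^sub>i\<close> be their difference, an element of the bidual.
  It is invariant under \<open>e\<^sub>i\<close>, so that \<open>D\<^sub>i \<cdot> l\<close> is \<open>e\<^sub>i\<close>-periodic for every functional \<open>l\<close>; it
  annihilates the \<open>e\<^sub>i\<close>-periodic functionals; and every \<open>\<Psi>\<close> preserves periodicity. Hence
  \<open>D\<^sub>i \<box> \<Psi> \<box> D\<^sub>i = 0\<close> for all \<open>\<Psi>\<close> (\<open>arens_square_zero\<close>).

  For \<open>S = D\<^sub>0 + \<dots> + D\<^sub>k\<^sub>-\<^sub>1\<close>, each term of the expansion of \<open>(\<Psi> \<box> S)\<close> to the power \<open>k + 1\<close> repeats
  some \<open>D\<^sub>i\<close> and therefore vanishes (\<open>power_mult_sum_square_zero\<close>). So \<open>S\<close> lies in the radical and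
  has index at most \<open>k + 1\<close>. The \<open>k\<close>-th power of \<open>S\<close> is the sum of the \<open>k!\<close> products of the \<open>D\<^sub>i\<close>
  in different orders, which are iterated limits in different orders; it is nonzero because a
  suitable function is annihilated by all of these limits but one.
  Let \<open>\<chi>\<^sub>j\<close> be the indicator function of \<open>0 < s\<^sub>0 < s\<^sub>1 < \<dots> < s\<^sub>j\<^sub>-\<^sub>1\<close>. Sending \<open>s\<^sub>i\<close> to infinity
  with the other coordinates fixed violates these inequalities unless \<open>i\<close> is the last index, when it
  leaves those of \<open>\<chi>\<^sub>j\<^sub>-\<^sub>1\<close>; sending it to minus infinity always violates them. Hence
  \<open>S \<cdot> \<chi>\<^sub>j = \<chi>\<^sub>j\<^sub>-\<^sub>1\<close> for \<open>1 \<le> j \<le> k\<close>, and the \<open>k\<close>-th power of \<open>S\<close> maps \<open>\<chi>\<^sub>k\<close> to the constant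
  function \<open>\<chi>\<^sub>0 = 1\<close>. With \<open>k = n - 1\<close> this gives index exactly \<open>n\<close>.\<close>

section \<open>Banach limits\<close>

text \<open>The role of a free ultrafilter is played by a filter \<open>G\<close> along which all bounded sequences
  converge. By Tychonoff's theorem the evaluations \<open>c \<mapsto> c n\<close>, as points of a product of closed
  discs, have a cluster point as \<open>n\<close> tends to infinity; \<open>G\<close> is generated by the tails of the index
  set together with the sets of indices at which the evaluation lies in a given neighbourhood of that
  point.\<close>

lemma limit_filter_exists:
  "\<exists>G. G \<noteq> bot \<and> G \<le> sequentially \<and>
     (\<forall>c::nat \<Rightarrow> complex. bounded (range c) \<longrightarrow> (\<exists>x. (c \<longlongrightarrow> x) G))"
proof -
  \<comment> \<open>Unbounded sequences are sent to 0, so that every factor of the product is compact.\<close>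
  define R :: "(nat \<Rightarrow> complex) \<Rightarrow> real"
    where "R c = (if bounded (range c) then SOME r. \<forall>n. norm (c n) \<le> r else 0)" for c
  define X :: "nat \<Rightarrow> (nat \<Rightarrow> complex) \<Rightarrow> complex"
    where "X n c = (if bounded (range c) then c n else 0)" for n c
  define K where "K = Pi\<^sub>E UNIV (\<lambda>c. cball (0::complex) (R c))"
  have "norm (c n) \<le> R c" if "bounded (range c)" for c n
  proof -
    have "\<exists>r. \<forall>n. norm (c n) \<le> r" using that by (auto simp: bounded_iff)
    from someI_ex[OF this] that show ?thesis by (simp add: R_def)
  qed
  then have X_K: "X n \<in> K" for n
    by (auto simp: X_def K_def R_def PiE_def)
  have "compactin (product_topology (\<lambda>_. euclidean) UNIV) K"
    unfolding K_def by (simp add: compactin_PiE)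
  then have "compact K" by (simp only: euclidean_product_topology compactin_euclidean_iff)
  then obtain x where x: "inf (nhds x) (filtermap X sequentially) \<noteq> bot"
    unfolding compact_filter using X_K
    by (auto simp: eventually_filtermap filtermap_bot_iff dest!: spec[of _ "filtermap X sequentially"])
  define G where "G = inf sequentially (filtercomap X (nhds x))"
  have "G \<noteq> bot"
  proof
    assume "G = bot"
    then have "eventually (\<lambda>_. False) G" by simp
    then obtain P Q where PQ: "eventually P sequentially" "eventually Q (nhds x)"
      "\<And>n. P n \<Longrightarrow> Q (X n) \<Longrightarrow> False"
      unfolding G_def eventually_inf eventually_filtercomap by blast
    have "eventually (\<lambda>y. \<not> Q y) (filtermap X sequentially)"
      unfolding eventually_filtermap by (rule eventually_mono[OF PQ(1)]) (use PQ(3) in auto)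
    with PQ(2) have "eventually (\<lambda>_. False) (inf (nhds x) (filtermap X sequentially))"
      unfolding eventually_inf by blast
    with x show False by (simp add: trivial_limit_def)
  qed
  moreover have "G \<le> sequentially" by (simp add: G_def)
  moreover have "\<exists>y. (c \<longlongrightarrow> y) G" if "bounded (range c)" for c :: "nat \<Rightarrow> complex"
  proof -
    have "(X \<longlongrightarrow> x) G"
      by (rule filterlim_mono[OF filterlim_filtercomap order_refl]) (simp add: G_def)
    moreover have "((\<lambda>f. f c :: complex) \<longlongrightarrow> x c) (nhds x)"
      using continuous_on_product_coordinates[of c, where 'b = complex]
      by (simp add: continuous_on_def flip: tendsto_at_iff_tendsto_nhds[of "\<lambda>f. f c" x])
    ultimately have "((\<lambda>n. X n c) \<longlongrightarrow> x c) G"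
      by (rule filterlim_compose[rotated])
    with that show ?thesis by (auto simp: X_def)
  qed
  ultimately show ?thesis by blast
qed

locale banach_limit =
  fixes B :: "(nat \<Rightarrow> complex) \<Rightarrow> complex"
  assumes add: "bounded (range c) \<Longrightarrow> bounded (range d) \<Longrightarrow> B (\<lambda>n. c n + d n) = B c + B d"
    and scale: "bounded (range c) \<Longrightarrow> B (\<lambda>n. z * c n) = z * B c"
    and norm_le: "(\<And>n. norm (c n) \<le> K) \<Longrightarrow> norm (B c) \<le> K"
    and shift: "bounded (range c) \<Longrightarrow> B (\<lambda>n. c (Suc n)) = B c"
    and one: "B (\<lambda>_. 1) = 1"

text \<open>Limits of Cesaro averages: the averages of a bounded sequence and of its shift differ by at most
  a constant over \<open>N\<close>.\<close>

lemma banach_limit_exists: "\<exists>B. banach_limit B"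
proof -
  obtain G where G: "G \<noteq> bot" "G \<le> sequentially"
    and lim: "\<And>c::nat \<Rightarrow> complex. bounded (range c) \<Longrightarrow> \<exists>x. (c \<longlongrightarrow> x) G"
    using limit_filter_exists by blast
  define avg :: "(nat \<Rightarrow> complex) \<Rightarrow> nat \<Rightarrow> complex"
    where "avg = (\<lambda>c N. (\<Sum>m<N. c m) / of_nat N)"
  define B where "B c = Lim G (avg c)" for c
  have avg_le: "norm (avg c N) \<le> K" if K: "\<forall>n. norm (c n) \<le> K" for c K N
  proof -
    have "norm (\<Sum>m<N. c m) \<le> (\<Sum>m<N. K)" by (rule sum_norm_le) (use K in auto)
    then show ?thesis
      using order_trans[OF norm_ge_zero, of "c 0" K] K
      by (cases "N = 0") (auto simp: avg_def norm_divide field_simps)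
  qed
  have bdd: "bounded (range (avg c))" if c: "bounded (range c)" for c
  proof -
    from c obtain K where "\<forall>n. norm (c n) \<le> K" by (auto simp: bounded_iff)
    from avg_le[OF this] show ?thesis by (auto simp: bounded_iff)
  qed
  have B: "(avg c \<longlongrightarrow> B c) G" if "bounded (range c)" for c
    using lim[OF bdd[OF that]] tendsto_Lim[OF G(1)] unfolding B_def by metis
  have eq: "B c = x" if "(avg c \<longlongrightarrow> x) G" for c x
    unfolding B_def by (rule tendsto_Lim[OF G(1) that])
  have "B (\<lambda>n. c n + d n) = B c + B d" if "bounded (range c)" "bounded (range d)" for c d
    using tendsto_add[OF B[OF that(1)] B[OF that(2)]]
    by (intro eq) (simp add: avg_def sum.distrib add_divide_distrib)
  moreover have "B (\<lambda>n. z * c n) = z * B c" if "bounded (range c)" for z c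
    using tendsto_mult_left[OF B[OF that], of z]
    by (intro eq) (simp add: avg_def sum_distrib_left)
  moreover have "norm (B c) \<le> K" if K: "\<forall>n. norm (c n) \<le> K" for c K
  proof (rule tendsto_le[OF G(1) tendsto_const])
    show "((\<lambda>N. norm (avg c N)) \<longlongrightarrow> norm (B c)) G"
      using K by (intro tendsto_norm B) (auto simp: bounded_iff)
  qed (simp add: avg_le[OF K])
  moreover have "B (\<lambda>n. c (Suc n)) = B c" if c: "bounded (range c)" for c
  proof -
    from c obtain K where K: "\<And>n. norm (c n) \<le> K" by (auto simp: bounded_iff)
    have "(\<lambda>N. (c N - c 0) / of_nat N) \<longlonglongrightarrow> 0"
    proof (rule Lim_null_comparison)
      show "\<forall>\<^sub>F N in sequentially. norm ((c N - c 0) / of_nat N) \<le> 2 * K / real N"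
      proof (rule always_eventually, rule allI)
        show "norm ((c N - c 0) / of_nat N) \<le> 2 * K / real N" for N
          using norm_triangle_ineq4[of "c N" "c 0"] K[of N] K[of 0]
          by (auto simp: norm_divide intro!: divide_right_mono)
      qed
      show "(\<lambda>N. 2 * K / real N) \<longlonglongrightarrow> 0" by (rule lim_const_over_n)
    qed
    then have "((\<lambda>N. (c N - c 0) / of_nat N) \<longlongrightarrow> 0) G"
      using G(2) by (rule tendsto_mono[rotated])
    then have "((\<lambda>N. avg c N + (c N - c 0) / of_nat N) \<longlongrightarrow> B c) G"
      using tendsto_add[OF B[OF c]] by fastforce
    moreover have "(\<Sum>n<N. c (Suc n)) = (\<Sum>n<N. c n) + (c N - c 0)" for N
      using sum_lessThan_telescope[of c N] by (simp add: sum_subtractf algebra_simps)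
    then have "avg (\<lambda>n. c (Suc n)) = (\<lambda>N. avg c N + (c N - c 0) / of_nat N)"
      by (simp add: avg_def add_divide_distrib)
    ultimately show ?thesis by (intro eq) simp
  qed
  moreover have "B (\<lambda>_. 1) = 1"
  proof (rule eq, rule tendsto_eventually)
    have "\<forall>\<^sub>F N in sequentially. avg (\<lambda>_. 1) N = 1"
      using eventually_gt_at_top[of 0] by eventually_elim (simp add: avg_def)
    then show "\<forall>\<^sub>F N in G. avg (\<lambda>_. 1) N = 1" using G(2) by (rule filter_leD[rotated])
  qed
  ultimately show ?thesis by (intro exI[of _ B] banach_limit.intro) blast+
qed

context banach_limit
begin

lemma diff:
  assumes "bounded (range c)" "bounded (range d)"
  shows "B (\<lambda>n. c n - d n) = B c - B d"
proof -
  have "bounded (range (\<lambda>n. - 1 * d n))" using assms(2) by (auto simp: bounded_iff)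
  from add[OF assms(1) this] scale[OF assms(2), of "-1"] show ?thesis by simp
qed

text \<open>By shift invariance only the tails of \<open>c\<close> matter, and these are close to the constant \<open>x\<close>.\<close>

lemma eq_lim:
  assumes c: "c \<longlonglongrightarrow> x"
  shows "B c = x"
proof -
  have bdd: "bounded (range (\<lambda>n. c (n + N)))" for N
    by (rule bounded_subset[OF convergent_imp_bounded[OF c]]) auto
  have shift_by: "B (\<lambda>n. c (n + N)) = B c" for N
    using shift[OF bdd] by (induction N) simp_all
  have const: "B (\<lambda>_. x) = x"
    using scale[of "\<lambda>_. 1" x] by (simp add: one)
  have "norm (B c - x) \<le> 0 + e" if "e > 0" for e
  proof -
    obtain N where N: "\<And>n. n \<ge> N \<Longrightarrow> norm (c n - x) < e"
      using c \<open>e > 0\<close> by (auto simp: LIMSEQ_iff)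
    have "norm (B (\<lambda>n. c (n + N) - x)) \<le> e"
      by (rule norm_le) (simp add: N less_imp_le)
    also have "B (\<lambda>n. c (n + N) - x) = B c - x"
      using diff[OF bdd[of N], of "\<lambda>_. x"] by (simp add: shift_by const)
    finally show ?thesis by simp
  qed
  then have "norm (B c - x) \<le> 0" by (rule field_le_epsilon)
  then show ?thesis by simp
qed

end


section \<open>Square-zero ideals from invariant functionals\<close>

lemma cdual_ract_ract: "cdual_ract (cdual_ract l a) b = cdual_ract l (a * b)"
  by (rule cdual_eqI) (simp add: mult.assoc)

lemma cdual_ract_lact: "cdual_ract (cdual_lact \<Phi> l) a = cdual_lact \<Phi> (cdual_ract l a)"
  by (rule cdual_eqI) (simp add: cdual_ract_ract)

lemma cdual_lact_arens: "cdual_lact (\<Psi> \<box> \<Phi>) l = cdual_lact \<Psi> (cdual_lact \<Phi> l)"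
  by (rule cdual_eqI) (simp flip: cdual_ract_lact)

text \<open>For a point mass \<open>u\<close> of a group algebra with inverse \<open>v\<close> this is the difference of the means at
  plus and minus infinity along the cyclic subgroup generated by \<open>u\<close>. Multiplication by \<open>u\<close> shifts the
  sequence of powers of \<open>u\<close> forwards and that of powers of \<open>v\<close> backwards, which a Banach limit does
  not see.\<close>

lemma difference_of_means_exists:
  fixes u v :: "'a::complex_banach_algebra_1"
  assumes uv: "u * v = 1" and bound: "\<And>m. norm (u ^ m) \<le> K" "\<And>m. norm (v ^ m) \<le> K"
  shows "\<exists>\<Phi>::'a cdual cdual. (\<forall>l. cdual_apply \<Phi> (cdual_ract l u) = cdual_apply \<Phi> l) \<and>
    (\<forall>l x. (\<lambda>m. cdual_apply l (u ^ m) - cdual_apply l (v ^ m)) \<longlonglongrightarrow> x \<longrightarrow> cdual_apply \<Phi> l = x)"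
proof -
  obtain B where "banach_limit B" using banach_limit_exists by blast
  then interpret banach_limit B .
  define \<phi> where "\<phi> = (\<lambda>(l :: 'a cdual) m. cdual_apply l (u ^ m) - cdual_apply l (v ^ m))"
  have le_w: "norm (cdual_apply l (w ^ m)) \<le> norm l * K" if "w \<in> {u, v}" for l :: "'a cdual" and w m
    using order_trans[OF norm_cdual_apply mult_left_mono[OF _ norm_ge_zero]] bound that by blast
  have le_\<phi>: "norm (\<phi> l m) \<le> norm l * (2 * K)" for l m
    using norm_triangle_ineq4[of "cdual_apply l (u ^ m)" "cdual_apply l (v ^ m)"]
      le_w[of u l m] le_w[of v l m] by (simp add: \<phi>_def)
  have bdd_w: "bounded (range (\<lambda>m. cdual_apply l (w ^ m)))" if "w \<in> {u, v}" for l :: "'a cdual" and w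
    using le_w[OF that] by (auto simp: bounded_iff)
  have bdd: "bounded (range (\<phi> l))" for l
    using le_\<phi> by (auto simp: bounded_iff)
  have "bounded_clinear (\<lambda>l. B (\<phi> l))"
  proof (rule bounded_clinearI)
    show "B (\<phi> (l + l')) = B (\<phi> l) + B (\<phi> l')" for l l'
      using add[OF bdd bdd, of l l'] by (simp add: \<phi>_def algebra_simps)
    show "B (\<phi> (z *\<^sub>C l)) = z * B (\<phi> l)" for z l
      using scale[OF bdd, of z l] by (simp add: \<phi>_def algebra_simps)
    show "norm (B (\<phi> l)) \<le> norm l * (2 * K)" for l by (rule norm_le) (rule le_\<phi>)
  qed
  then obtain \<Phi> :: "'a cdual cdual" where \<Phi>: "\<And>l. cdual_apply \<Phi> l = B (\<phi> l)"
    using cdual_apply_Cdual by metis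
  have "cdual_apply \<Phi> (cdual_ract l u) = cdual_apply \<Phi> l" for l
  proof -
    \<comment> \<open>Since \<open>u * v = 1\<close>, the shift of \<open>?dv\<close> is \<open>?cv\<close>, while \<open>?du\<close> is the shift of \<open>?cu\<close>.\<close>
    let ?cu = "\<lambda>m. cdual_apply l (u ^ m)" and ?cv = "\<lambda>m. cdual_apply l (v ^ m)"
    let ?du = "\<lambda>m. cdual_apply l (u * u ^ m)" and ?dv = "\<lambda>m. cdual_apply l (u * v ^ m)"
    have bd: "bounded (range ?du)" "bounded (range ?dv)"
      using bdd_w[of u "cdual_ract l u"] bdd_w[of v "cdual_ract l u"] by simp_all
    have "B ?du = B ?cu" using shift[OF bdd_w[of u l]] by simp
    moreover have "B ?dv = B ?cv" using shift[OF bd(2)] by (simp add: uv flip: mult.assoc)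
    ultimately show ?thesis
      using diff[OF bdd_w bdd_w, of u v l l] diff[OF bd] by (simp add: \<Phi> \<phi>_def)
  qed
  moreover have "cdual_apply \<Phi> l = x"
    if "(\<lambda>m. cdual_apply l (u ^ m) - cdual_apply l (v ^ m)) \<longlonglongrightarrow> x" for l x
    unfolding \<Phi> using that by (intro eq_lim) (simp add: \<phi>_def)
  ultimately show ?thesis by blast
qed

text \<open>Call \<open>l\<close> periodic if \<open>l \<cdot> u = l\<close>. As \<open>\<Phi>\<close> is invariant under \<open>u\<close> and \<open>u\<close> is central, the functional
  \<open>\<Phi> \<cdot> l\<close> is periodic, and then so is \<open>\<Psi> \<cdot> (\<Phi> \<cdot> l)\<close>. If \<open>p\<close> is periodic, then so are its translates
  \<open>p \<cdot> a\<close>; these are annihilated by \<open>\<Phi>\<close>, hence \<open>\<Phi> \<cdot> p = 0\<close>.\<close>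

lemma arens_square_zero:
  fixes u :: "'a::complex_banach_algebra_1"
  assumes central: "\<And>a. u * a = a * u"
    and inv: "\<And>l. cdual_apply \<Phi> (cdual_ract l u) = cdual_apply \<Phi> l"
    and per: "\<And>l. cdual_ract l u = l \<Longrightarrow> cdual_apply \<Phi> l = 0"
  shows "\<Phi> \<box> \<Psi> \<box> \<Phi> = 0"
proof -
  have commute: "cdual_ract (cdual_ract l a) u = cdual_ract (cdual_ract l u) a" for l a
    by (simp add: cdual_ract_ract central)
  have inv_lact: "cdual_ract (cdual_lact \<Phi> l) u = cdual_lact \<Phi> l" for l
    by (rule cdual_eqI) (simp add: central inv flip: cdual_ract_ract)
  have "cdual_lact \<Phi> l = 0" if "cdual_ract l u = l" for l
    by (rule cdual_eqI) (simp add: per commute that)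
  then have "cdual_lact \<Phi> (cdual_lact \<Psi> (cdual_lact \<Phi> l)) = 0" for l
    by (metis cdual_ract_lact inv_lact)
  then have "cdual_lact (\<Phi> \<box> \<Psi> \<box> \<Phi>) l = 0" for l by (simp add: cdual_lact_arens)
  moreover have "cdual_apply \<Theta> l = cdual_apply (cdual_lact \<Theta> l) 1" for \<Theta> and l :: "'a cdual"
  proof -
    have "cdual_ract l 1 = l" by (rule cdual_eqI) simp
    then show ?thesis by simp
  qed
  ultimately show ?thesis by (intro cdual_eqI) (metis cdual_apply_simps(1))
qed


section \<open>Sums of generators of square-zero ideals\<close>

text \<open>Expanding the power gives words in the \<open>d i\<close> with more letters than \<open>I\<close> has elements, so some
  letter occurs twice. To avoid the expansion, multiply on the right by an \<open>x\<close> for which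
  all letters outside \<open>J\<close> are already used up, in the sense that \<open>d i * c * x = 0\<close> for all \<open>c\<close>. Each
  factor \<open>b * sum d I\<close> then uses up one more letter, and the proof is an induction on the size of
  \<open>J\<close>.\<close>

lemma power_mult_sum_square_zero:
  fixes d :: "'i \<Rightarrow> 'b::{ring, monoid_mult}"
  assumes I: "finite I" and sq: "\<And>i b. i \<in> I \<Longrightarrow> d i * b * d i = 0"
  shows "(b * sum d I) ^ Suc (card I) = 0"
proof -
  have "(b * sum d I) ^ Suc (card J) * x = 0"
    if "J \<subseteq> I" and "\<And>i c. i \<in> I - J \<Longrightarrow> d i * c * x = 0" for J x
    using that
  proof (induction "card J" arbitrary: J x)
    case 0
    have "d i * x = 0" if "i \<in> I" for i
      using 0 I that mult_1_right by (metis card_0_eq rev_finite_subset Diff_empty)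
    then have "sum d I * x = 0" by (simp add: sum_distrib_right)
    with 0 show ?case by (simp add: mult.assoc)
  next
    case (Suc m)
    have "finite J" using Suc.prems(1) I by (rule finite_subset)
    have "(b * sum d I) ^ Suc m * (b * (d i * x)) = 0" if "i \<in> I" for i
    proof (cases "i \<in> J")
      case True
      have "m = card (J - {i})" using Suc.hyps(2) True \<open>finite J\<close> by simp
      moreover have "d j * c * (b * (d i * x)) = 0" if "j \<in> I - (J - {i})" for j c
      proof (cases "j = i")
        case True
        then show ?thesis using sq[OF \<open>i \<in> I\<close>, of "c * b"] by (simp flip: mult.assoc)
      next
        case False
        then show ?thesis using Suc.prems(2)[of j "c * b * d i"] that by (simp add: mult.assoc)
      qed
      ultimately show ?thesis
        using Suc.hyps(1)[of "J - {i}" "b * (d i * x)"] Suc.prems(1) by auto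
    next
      case False
      then show ?thesis using Suc.prems(2)[of i 1] \<open>i \<in> I\<close> by simp
    qed
    then have "(b * sum d I) ^ Suc m * (b * (sum d I * x)) = 0"
      by (simp add: sum_distrib_left sum_distrib_right)
    moreover have "(b * sum d I) ^ Suc (card J) * x = (b * sum d I) ^ Suc m * (b * (sum d I * x))"
      unfolding Suc.hyps(2)[symmetric] power_Suc2[of _ "Suc m"] by (simp only: mult.assoc)
    ultimately show ?case by simp
  qed
  from this[of I 1] show ?thesis by simp
qed

lemma quasi_nilpotent_if_power_eq_0:
  assumes "a ^ m = 0"
  shows "quasi_nilpotent a"
proof -
  have "\<forall>\<^sub>F n in sequentially. root n (norm (a ^ n)) = 0"
    using eventually_ge_at_top[of m]
  proof eventually_elim
    case (elim n)
    then have "a ^ n = a ^ m * a ^ (n - m)" by (simp flip: power_add)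
    with assms show ?case by simp
  qed
  then show ?thesis unfolding quasi_nilpotent_def by (rule tendsto_eventually)
qed


section \<open>Point masses and bounded functions\<close>

lift_definition ell1_delta :: "'g \<Rightarrow> 'g ell1" is "\<lambda>x y. if y = x then 1 else 0"
proof -
  fix x :: 'g
  have "(\<lambda>y. norm (if y = x then 1 else 0 :: complex)) summable_on {x}" by simp
  then show "(\<lambda>y. norm (if y = x then 1 else 0 :: complex)) summable_on UNIV"
    by (rule summable_on_cong_neutral[THEN iffD1, rotated 3]) auto
qed

lemma norm_ell1_delta: "norm (ell1_delta x) = 1"
proof -
  have "(\<Sum>\<^sub>\<infinity>y. norm (if y = x then 1 else 0 :: complex)) = (\<Sum>\<^sub>\<infinity>y\<in>{x}. 1)"
    by (rule infsum_cong_neutral) auto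
  then show ?thesis by (simp add: norm_ell1.rep_eq ell1_delta.rep_eq)
qed

lemma ell1_delta_mult_apply:
  fixes x :: "'g::group_add"
  shows "ell1_apply (ell1_delta x * f) z = ell1_apply f (- x + z)"
proof -
  have "(\<Sum>\<^sub>\<infinity>y. (if y = x then 1 else 0) * ell1_apply f (- y + z)) = (\<Sum>\<^sub>\<infinity>y\<in>{x}. ell1_apply f (- x + z))"
    by (rule infsum_cong_neutral) auto
  then show ?thesis by (simp add: times_ell1.rep_eq ell1_delta.rep_eq convolve_def)
qed

lemma ell1_mult_delta_apply:
  fixes x :: "'g::ab_group_add"
  shows "ell1_apply (f * ell1_delta x) z = ell1_apply f (- x + z)"
proof -
  have "(\<Sum>\<^sub>\<infinity>y. ell1_apply f y * (if - y + z = x then 1 else 0)) = (\<Sum>\<^sub>\<infinity>y\<in>{- x + z}. ell1_apply f (- x + z))"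
    by (rule infsum_cong_neutral) (auto simp: algebra_simps)
  then show ?thesis by (simp add: times_ell1.rep_eq ell1_delta.rep_eq convolve_def)
qed

lemma ell1_delta_central: "ell1_delta (x :: 'g::ab_group_add) * f = f * ell1_delta x"
  by (rule ell1_eqI) (simp add: ell1_delta_mult_apply ell1_mult_delta_apply)

lemma ell1_delta_mult: "ell1_delta (x :: 'g::ab_group_add) * ell1_delta y = ell1_delta (x + y)"
  by (rule ell1_eqI) (auto simp: ell1_delta_mult_apply ell1_delta.rep_eq algebra_simps)

lemma ell1_delta_0: "ell1_delta (0 :: 'g::ab_group_add) = 1"
  by (rule ell1_eqI) (simp add: ell1_delta.rep_eq one_ell1.rep_eq)

lemma ell1_has_sum_delta: "((\<lambda>x. ell1_apply f x *\<^sub>C ell1_delta x) has_sum f) UNIV"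
proof -
  have apply_sum: "ell1_apply (\<Sum>x\<in>F. ell1_apply f x *\<^sub>C ell1_delta x) y = (if y \<in> F then ell1_apply f y else 0)"
    if "finite F" for F y
    using that by induction (auto simp: zero_ell1.rep_eq plus_ell1.rep_eq scaleC_ell1.rep_eq ell1_delta.rep_eq)
  let ?n = "\<lambda>x. norm (ell1_apply f x)"
  have "norm ((\<Sum>x\<in>F. ell1_apply f x *\<^sub>C ell1_delta x) - f) = norm f - sum ?n F" if "finite F" for F
  proof -
    have "norm ((\<Sum>x\<in>F. ell1_apply f x *\<^sub>C ell1_delta x) - f) = infsum ?n (UNIV - F)"
      unfolding norm_ell1.rep_eq
      by (rule infsum_cong_neutral) (auto simp: minus_ell1.rep_eq apply_sum[OF that])
    also have "\<dots> = infsum ?n UNIV - infsum ?n F"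
      by (rule infsum_Diff) (use that ell1_summable[of f] in auto)
    finally show ?thesis using that by (simp add: norm_ell1.rep_eq)
  qed
  then have "\<forall>\<^sub>F F in finite_subsets_at_top UNIV.
      norm f - sum ?n F = norm ((\<Sum>x\<in>F. ell1_apply f x *\<^sub>C ell1_delta x) - f)"
    by (intro eventually_finite_subsets_at_top_weakI) simp
  moreover have "((\<lambda>F. norm f - sum ?n F) \<longlongrightarrow> norm f - norm f) (finite_subsets_at_top UNIV)"
    using has_sum_infsum[OF ell1_summable[of f]]
    unfolding has_sum_def norm_ell1.rep_eq by (intro tendsto_diff tendsto_const)
  ultimately have "((\<lambda>F. norm ((\<Sum>x\<in>F. ell1_apply f x *\<^sub>C ell1_delta x) - f)) \<longlongrightarrow> 0) (finite_subsets_at_top UNIV)"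
    by (simp add: Lim_transform_eventually)
  then show ?thesis
    unfolding has_sum_def by (simp add: LIM_zero_iff tendsto_norm_zero_iff)
qed

text \<open>The point masses span a dense subspace.\<close>

lemma ell1_cdual_eqI:
  fixes l m :: "'g ell1 cdual"
  assumes "\<And>x. cdual_apply l (ell1_delta x) = cdual_apply m (ell1_delta x)"
  shows "l = m"
proof (rule cdual_eqI)
  fix f :: "'g ell1"
  have "((\<lambda>x. ell1_apply f x * cdual_apply k (ell1_delta x)) has_sum cdual_apply k f) UNIV" for k
    using has_sum_bounded_linear[OF bounded_linear_cdual_apply ell1_has_sum_delta, of k f]
    by (simp add: o_def cdual_apply_scaleC_right)
  from this[of l] this[of m] show "cdual_apply l f = cdual_apply m f"
    by (simp add: assms has_sum_unique)
qed

lemma bounded_function_functional: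
  fixes h :: "'g \<Rightarrow> complex"
  assumes h: "bounded (range h)"
  shows "\<exists>l. \<forall>x. cdual_apply l (ell1_delta x) = h x"
proof -
  from h obtain K where K: "\<And>x. norm (h x) \<le> K" by (auto simp: bounded_iff)
  let ?L = "\<lambda>f. \<Sum>\<^sub>\<infinity>x. h x * ell1_apply f x"
  have le: "norm (h x * ell1_apply f x) \<le> K * norm (ell1_apply f x)" for f x
    by (simp add: norm_mult mult_right_mono K)
  have abs: "(\<lambda>x. norm (h x * ell1_apply f x)) summable_on UNIV" for f
    by (rule Infinite_Sum.abs_summable_on_comparison_test'
        [OF summable_on_cmult_right[OF ell1_summable[of f], of K] le])
  note summ = abs_summable_summable[OF abs]
  have "bounded_clinear ?L"
  proof (rule bounded_clinearI)
    show "?L (f + g) = ?L f + ?L g" for f g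
      by (simp add: plus_ell1.rep_eq distrib_left infsum_add[OF summ summ])
    show "?L (c *\<^sub>C f) = c * ?L f" for c f
      by (simp add: scaleC_ell1.rep_eq mult.left_commute[of _ c] infsum_cmult_right')
    show "norm (?L f) \<le> norm f * K" for f
    proof -
      have "norm (?L f) \<le> (\<Sum>\<^sub>\<infinity>x. norm (h x * ell1_apply f x))"
        by (rule norm_infsum_bound[OF abs])
      also have "\<dots> \<le> (\<Sum>\<^sub>\<infinity>x. K * norm (ell1_apply f x))"
        by (rule infsum_mono[OF abs summable_on_cmult_right[OF ell1_summable] le])
      finally show ?thesis by (simp add: infsum_cmult_right' norm_ell1.rep_eq mult.commute)
    qed
  qed
  moreover have "?L (ell1_delta x) = h x" for x
  proof -
    have "?L (ell1_delta x) = (\<Sum>\<^sub>\<infinity>y\<in>{x}. h x)"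
      by (rule infsum_cong_neutral) (auto simp: ell1_delta.rep_eq)
    then show ?thesis by simp
  qed
  ultimately show ?thesis by (intro exI[of _ "Cdual ?L"]) (simp add: cdual_apply_Cdual)
qed


section \<open>Nilpotent elements in the radical\<close>

lemma ell1_delta_single_power:
  "ell1_delta (Poly_Mapping.single i c) ^ m = ell1_delta (Poly_Mapping.single i (int m * c))"
  by (induction m) (simp_all add: ell1_delta_0 ell1_delta_mult distrib_right flip: single_add)

text \<open>The set \<open>0 < s\<^sub>0 < \<dots> < s\<^sub>j\<^sub>-\<^sub>1\<close>; in particular \<open>increasing_cone 0\<close> is the whole group.\<close>

definition increasing_cone :: "nat \<Rightarrow> (nat \<Rightarrow>\<^sub>0 int) set" where
  "increasing_cone j = {s. \<forall>i<j. 0 < Poly_Mapping.lookup s i \<and> (\<forall>h<i. Poly_Mapping.lookup s h < Poly_Mapping.lookup s i)}"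

definition cone_functional :: "nat \<Rightarrow> (nat \<Rightarrow>\<^sub>0 int) ell1 cdual" where
  "cone_functional j = (SOME l. \<forall>s. cdual_apply l (ell1_delta s) = indicator (increasing_cone j) s)"

lemma cone_functional: "cdual_apply (cone_functional j) (ell1_delta s) = indicator (increasing_cone j) s"
proof -
  have "bounded (range (indicator (increasing_cone j) :: (nat \<Rightarrow>\<^sub>0 int) \<Rightarrow> complex))"
    by (rule bounded_subset[of "{0, 1}"]) (auto simp: indicator_def)
  from someI_ex[OF bounded_function_functional[OF this]]
  show ?thesis unfolding cone_functional_def by blast
qed

text \<open>Both terms are eventually constant in \<open>m\<close>: for \<open>i > j\<close> they agree, as the cone does not depend on
  the \<open>i\<close>-th coordinate; for \<open>i \<le> j\<close> the second one vanishes because the coordinate becomes negative, and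
  the first one vanishes for \<open>i < j\<close> because the \<open>i\<close>-th coordinate overtakes the \<open>j\<close>-th.\<close>

lemma cone_difference_tendsto:
  "(\<lambda>m. indicator (increasing_cone (Suc j)) (t + Poly_Mapping.single i (int m))
      - indicator (increasing_cone (Suc j)) (t - Poly_Mapping.single i (int m)) :: complex)
    \<longlonglongrightarrow> (if i = j then indicator (increasing_cone j) t else 0)"
proof (cases "i > j")
  case True
  then have "t + Poly_Mapping.single i z \<in> increasing_cone (Suc j) \<longleftrightarrow> t \<in> increasing_cone (Suc j)"
    and "t - Poly_Mapping.single i z \<in> increasing_cone (Suc j) \<longleftrightarrow> t \<in> increasing_cone (Suc j)" for z
    by (simp_all add: increasing_cone_def lookup_add lookup_minus lookup_single)
  with True show ?thesis by (simp add: indicator_def)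
next
  case False
  define M where "M = nat (\<bar>Poly_Mapping.lookup t i\<bar> + (\<Sum>h\<le>j. \<bar>Poly_Mapping.lookup t h\<bar>)) + 1"
  have M: "int m > \<bar>Poly_Mapping.lookup t i\<bar> + \<bar>Poly_Mapping.lookup t h\<bar>" if "m \<ge> M" "h \<le> j" for m h
    using that member_le_sum[of h "{..j}" "\<lambda>h. \<bar>Poly_Mapping.lookup t h\<bar>"] by (simp add: M_def)
  have "t - Poly_Mapping.single i (int m) \<notin> increasing_cone (Suc j)" if "m \<ge> M" for m
  proof
    assume "t - Poly_Mapping.single i (int m) \<in> increasing_cone (Suc j)"
    with False have "0 < Poly_Mapping.lookup (t - Poly_Mapping.single i (int m)) i"
      by (simp add: increasing_cone_def)
    with M[OF that, of i] False show False by (simp add: lookup_minus)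
  qed
  moreover have "t + Poly_Mapping.single i (int m) \<in> increasing_cone (Suc j) \<longleftrightarrow> i = j \<and> t \<in> increasing_cone j"
    if "m \<ge> M" for m
  proof (cases "i = j")
    case True
    have "Poly_Mapping.lookup t h < Poly_Mapping.lookup t j + int m" if "h < j" for h
      using M[OF \<open>m \<ge> M\<close>, of h] that True by simp
    moreover have "0 < Poly_Mapping.lookup t j + int m" using M[OF \<open>m \<ge> M\<close>, of j] True by simp
    ultimately show ?thesis using True
      by (auto simp: increasing_cone_def lookup_add lookup_single when_def less_Suc_eq)
  next
    case i: False
    with False have "i < j" by simp
    then have "\<not> Poly_Mapping.lookup (t + Poly_Mapping.single i (int m)) i < Poly_Mapping.lookup (t + Poly_Mapping.single i (int m)) j"
      using M[OF that, of j] i by (simp add: lookup_add lookup_single)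
    with \<open>i < j\<close> i show ?thesis by (auto simp: increasing_cone_def)
  qed
  ultimately have "\<forall>\<^sub>F m in sequentially.
    indicator (increasing_cone (Suc j)) (t + Poly_Mapping.single i (int m))
      - indicator (increasing_cone (Suc j)) (t - Poly_Mapping.single i (int m))
    = (if i = j then indicator (increasing_cone j) t else 0 :: complex)"
    by (intro eventually_sequentiallyI[of M]) (auto simp: indicator_def)
  then show ?thesis by (rule tendsto_eventually)
qed

text \<open>The elements \<open>D\<^sub>i\<close> of the outline. The second property says that \<open>D\<^sub>i\<close> removes the coordinate \<open>j\<close>
  from the cone functional of index \<open>Suc j\<close> if \<open>i = j\<close> and annihilates that functional otherwise.\<close>

lemma axis_means_exist:
  "\<exists>D. \<forall>i. (\<forall>\<Psi>. D i \<box> \<Psi> \<box> D i = 0) \<and>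
     (\<forall>j. cdual_lact (D i) (cone_functional (Suc j)) = (if i = j then cone_functional j else 0))"
proof (rule choice, rule allI)
  fix i :: nat
  let ?u = "ell1_delta (Poly_Mapping.single i (1::int))" and ?v = "ell1_delta (Poly_Mapping.single i (- 1 :: int))"
  have uv: "?u * ?v = 1" by (simp add: ell1_delta_mult ell1_delta_0 flip: single_add)
  have pow: "?u ^ m = ell1_delta (Poly_Mapping.single i (int m))"
      "?v ^ m = ell1_delta (Poly_Mapping.single i (- int m))" for m
    by (simp_all only: ell1_delta_single_power mult_1_right mult_minus1_right)
  have "norm (?u ^ m) \<le> 1" "norm (?v ^ m) \<le> 1" for m
    unfolding pow by (simp_all add: norm_ell1_delta)
  from difference_of_means_exists[OF uv this] obtain D where
    inv: "\<And>l. cdual_apply D (cdual_ract l ?u) = cdual_apply D l" and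
    lim: "\<And>l x. (\<lambda>m. cdual_apply l (?u ^ m) - cdual_apply l (?v ^ m)) \<longlonglongrightarrow> x \<Longrightarrow> cdual_apply D l = x"
    by blast
  have "cdual_apply D l = 0" if per: "cdual_ract l ?u = l" for l
  proof (rule lim)
    have u: "cdual_apply l (?u * a) = cdual_apply l a" for a
      using per by (metis cdual_apply_ract)
    have "cdual_apply l (?u ^ m) = cdual_apply l 1" for m
      by (induction m) (simp_all add: u)
    moreover have "cdual_apply l (?v ^ m) = cdual_apply l 1" for m
    proof (induction m)
      case (Suc m)
      with u[of "?v ^ Suc m"] uv show ?case by (simp flip: mult.assoc)
    qed simp
    ultimately show "(\<lambda>m. cdual_apply l (?u ^ m) - cdual_apply l (?v ^ m)) \<longlonglongrightarrow> 0" by simp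
  qed
  from arens_square_zero[OF ell1_delta_central inv this] have "D \<box> \<Psi> \<box> D = 0" for \<Psi> .
  moreover have "cdual_lact D (cone_functional (Suc j)) = (if i = j then cone_functional j else 0)" for j
  proof (rule ell1_cdual_eqI)
    fix t
    have "cdual_apply D (cdual_ract (cone_functional (Suc j)) (ell1_delta t))
      = (if i = j then indicator (increasing_cone j) t else 0)"
      using cone_difference_tendsto[of j t i]
      by (intro lim, unfold pow) (simp add: ell1_delta_mult cone_functional single_uminus)
    then show "cdual_apply (cdual_lact D (cone_functional (Suc j))) (ell1_delta t)
      = cdual_apply (if i = j then cone_functional j else 0) (ell1_delta t)"
      by (simp add: cone_functional)
  qed
  ultimately show "\<exists>D. (\<forall>\<Psi>. D \<box> \<Psi> \<box> D = 0) \<and>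
      (\<forall>j. cdual_lact D (cone_functional (Suc j)) = (if i = j then cone_functional j else 0))"
    by blast
qed

theorem theorem1p2:
  fixes n :: nat
  assumes "n \<ge> 1"
  shows "\<exists>a \<in> (jacobson_radical :: (nat \<Rightarrow>\<^sub>0 int) ell1 bidual set). nilpotent_of_index a n"
proof -
  obtain k where n: "n = Suc k" using assms by (cases n) auto
  from axis_means_exist obtain D where D: "\<forall>i. (\<forall>\<Psi>. D i \<box> \<Psi> \<box> D i = 0) \<and>
      (\<forall>j. cdual_lact (D i) (cone_functional (Suc j)) = (if i = j then cone_functional j else 0))" ..
  have sq: "D i \<box> \<Psi> \<box> D i = 0" for i \<Psi>
    by (rule spec[OF conjunct1[OF spec[OF D]]])
  have cone: "cdual_lact (D i) (cone_functional (Suc j)) = (if i = j then cone_functional j else 0)" for i j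
    by (rule spec[OF conjunct2[OF spec[OF D]]])
  define d where "d i = to_bidual (D i)" for i :: nat
  define a where "a = sum d {..<k}"
  have "d i * b * d i = 0" for i b
    by (simp add: times_bidual.rep_eq zero_bidual.rep_eq d_def to_bidual_inverse sq flip: of_bidual_inject)
  then have nil: "(b * a) ^ n = 0" for b
    using power_mult_sum_square_zero[of "{..<k}" d b] by (simp add: a_def n)
  have "a \<in> jacobson_radical"
    unfolding jacobson_radical_def using nil quasi_nilpotent_if_power_eq_0 by blast
  moreover have "a ^ k \<noteq> 0"
  proof
    assume "a ^ k = 0"
    \<comment> \<open>The action of \<open>a\<close> lowers the index of the cone functionals, from \<open>k\<close> down to the nonzero
      functional of index 0.\<close>
    have "of_bidual (sum d I) = sum D I" for I
      by (induction I rule: infinite_finite_induct)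
        (simp_all add: zero_bidual.rep_eq plus_bidual.rep_eq d_def to_bidual_inverse)
    then have a: "of_bidual a = sum D {..<k}" by (simp add: a_def)
    have lact_0: "cdual_lact 0 l = 0" for l :: "(nat \<Rightarrow>\<^sub>0 int) ell1 cdual"
      by (rule cdual_eqI) simp
    have lact_sum: "cdual_lact (sum D I) l = (\<Sum>i\<in>I. cdual_lact (D i) l)" for I l
      by (induction I rule: infinite_finite_induct) (simp_all add: lact_0 cdual_lact_linear)
    have step: "cdual_lact (of_bidual a) (cone_functional (Suc j)) = cone_functional j" if "j < k" for j
      using that by (simp add: a lact_sum cone)
    have "cdual_lact (of_bidual (a ^ j)) (cone_functional j) = cone_functional 0" if "j \<le> k" for j
      using that
    proof (induction j)
      case 0
      show ?case by (rule cdual_eqI) (simp add: one_bidual.rep_eq)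
    next
      case (Suc j)
      then show ?case
        by (simp only: power_Suc2 times_bidual.rep_eq cdual_lact_arens step Suc_le_eq less_imp_le)
    qed
    from this[of k] have "cone_functional 0 = 0"
      using \<open>a ^ k = 0\<close> by (simp add: zero_bidual.rep_eq lact_0)
    then show False
      using cone_functional[of 0 0] by (simp add: increasing_cone_def)
  qed
  ultimately show ?thesis
    using nil[of 1] by (intro bexI[of _ a]) (simp_all add: nilpotent_of_index_def n)
qed

end
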